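(* Let $\mu$ and $\nu$ be two atomless finite positive Borel measures on $\mathbb{R}$, with $\mu(\mathbb{R})=\nu(\mathbb{R})$, such that $\min_{\pi\in\mathrm{Marg}(\mu,\nu)}J(\pi)<+\infty$. Let $(I_k^+)_{k\in\mathcal{K}^+}$ and $(I_k^-)_{k\in\mathcal{K}^-}$ be the (countable) families of connected components of the open sets $\{F_\mu^+>F_\nu^+\}$ and $\{F_\mu^+<F_\nu^+\}$ respectively, and set $$\mu^= = \mu|_{\{F_\mu^+=F_\nu^+\}},\quad \nu^= = \nu|_{\{F_\mu^+=F_\nu^+\}},\quad \mu_k^\pm=\mu|_{I_k^\pm},\quad \nu_k^\pm=\nu|_{I_k^\pm}\qquad(k\in\mathcal{K}^\pm).$$ 1. Then $\mu^==\nu^=$, and for all $k\in\mathcal{K}^+$ (resp. $k\in\mathcal{K}^-$) we have $\mu_k^+\leq_{\mathrm F}\nu_k^+$ (resp. $\nu_k^-\leq_{\mathrm F}\mu_k^-$). 2. The set $\mathcal{O}(\mu,\nu)$ admits the decomposition $$\mathcal{O}(\mu,\nu)=\Big(\bigoplus_{k\in\mathcal{K}^+}\mathcal{O}(\mu_k^+,\nu_k^+)\Big)\oplus\Big(\bigoplus_{k\in\mathcal{K}^-}\mathcal{O}(\mu_k^-,\nu_k^-)\Big)\oplus\mathcal{O}(\mu^=,\nu^=).$$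
   Context: $\mathcal{M}_+(E)$ is the set of finite positive Borel measures on $E$. $\gamma|_A$ is the restriction $B\mapsto\gamma(A\cap B)$. $F_\gamma^+(t)=\gamma((-\infty,t])$ and $F_\gamma^-(t)=\gamma((-\infty,t))$; $\{F_\mu^+>F_\nu^+\}$ denotes $\{x\in\mathbb{R}: F_\mu^+(x)>F_\nu^+(x)\}$, and similarly for other relations. $\mathrm{Marg}(\mu,\nu)$ is the set of $\pi\in\mathcal{M}_+(\mathbb{R}^2)$ with first marginal $\mu$ and second marginal $\nu$. $J(\pi)=\int_{\mathbb{R}^2}|y-x|\,d\pi(x,y)$, and $\mathcal{O}(\mu,\nu)$ is the set of minimizers of $J$ over $\mathrm{Marg}(\mu,\nu)$. Order $\leq_{\mathrm F}$: for $\gamma_1,\gamma_2\in\mathcal{M}_+(\mathbb{R})$, $\gamma_1\leq_{\mathrm{st}}\gamma_2$ means $\gamma_1(\mathbb{R})=\gamma_2(\mathbb{R})$ and $F_{\gamma_1}^+\geq F_{\gamma_2}^+$. Let $T_\pm(\gamma_1,\gamma_2)=\{t\in\mathbb{R}: F_{\gamma_1}^\pm(t)>0\text{ and }F_{\gamma_2}^\pm(t)<\gamma_2(\mathbb{R})\}$. Then $\gamma_1\leq_{\mathrm F}\gamma_2$ means $\gamma_1\leq_{\mathrm{st}}\gamma_2$, $T_+(\gamma_1,\gamma_2)\subset\{F_{\gamma_1}^+>F_{\gamma_2}^+\}$ and $T_-(\gamma_1,\gamma_2)\subset\{F_{\gamma_1}^->F_{\gamma_2}^-\}$. Direct sums: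 for a countable family $(E_i)_{i\in I}$ of subsets of $\mathcal{M}_+(\mathbb{R}^2)$, $\sum_{i}E_i$ is the image of the map $(\pi_i)_{i}\in\prod_i E_i\mapsto\sum_i\pi_i$; it is written $\bigoplus_i E_i$ when this map is injective. Thus the displayed equality asserts that every sum of elements of the sets on the right lies in $\mathcal{O}(\mu,\nu)$ and that each $\pi\in\mathcal{O}(\mu,\nu)$ is such a sum in exactly one way. *)

theory Defs
  imports "HOL-Probability.Probability"
begin

(* The set M_+(E): finite positive Borel measures on the whole type 'a. *)
definition M_plus :: "'a::topological_space measure set" where
  "M_plus = {M. sets M = sets borel \<and> finite_measure M}"

(* This is F_M^-; the library's cdf M is F_M^+. *)
definition cdf_left :: "real measure \<Rightarrow> real \<Rightarrow> real" where
  "cdf_left M t = measure M {..<t}"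

definition atomless :: "real measure \<Rightarrow> bool" where
  "atomless M \<longleftrightarrow> (\<forall>x. emeasure M {x} = 0)"

(* Restriction keeps the ambient space, unlike restrict_space;
   see emeasure_restr for its values. *)
definition restr :: "real measure \<Rightarrow> real set \<Rightarrow> real measure" where
  "restr M A = density M (indicator A)"

lemma sets_restr [simp]: "sets (restr M A) = sets M"
  by (simp add: restr_def)

lemma emeasure_restr:
  assumes "A \<in> sets M" "B \<in> sets M"
  shows "emeasure (restr M A) B = emeasure M (A \<inter> B)"
  unfolding restr_def using assms by (rule emeasure_restricted)

definition Marg :: "real measure \<Rightarrow> real measure \<Rightarrow> (real \<times> real) measure set" where
  "Marg \<mu> \<nu> = {\<pi> \<in> M_plus. distr \<pi> borel fst = \<mu> \<and> distr \<pi> borel snd = \<nu>}"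

(* Valued in [0, \<infinity>], as the cost of a plan need not be finite. *)
definition J :: "(real \<times> real) measure \<Rightarrow> ennreal" where
  "J \<pi> = (\<integral>\<^sup>+ (x, y). ennreal \<bar>y - x\<bar> \<partial>\<pi>)"

definition Opt :: "real measure \<Rightarrow> real measure \<Rightarrow> (real \<times> real) measure set" where
  "Opt \<mu> \<nu> = {\<pi> \<in> Marg \<mu> \<nu>. \<forall>\<pi>' \<in> Marg \<mu> \<nu>. J \<pi> \<le> J \<pi>'}"

definition le_st :: "real measure \<Rightarrow> real measure \<Rightarrow> bool" where
  "le_st \<gamma>1 \<gamma>2 \<longleftrightarrow>
     measure \<gamma>1 UNIV = measure \<gamma>2 UNIV \<and> (\<forall>t. cdf \<gamma>1 t \<ge> cdf \<gamma>2 t)"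

definition T_plus :: "real measure \<Rightarrow> real measure \<Rightarrow> real set" where
  "T_plus \<gamma>1 \<gamma>2 = {t. cdf \<gamma>1 t > 0 \<and> cdf \<gamma>2 t < measure \<gamma>2 UNIV}"

definition T_minus :: "real measure \<Rightarrow> real measure \<Rightarrow> real set" where
  "T_minus \<gamma>1 \<gamma>2 = {t. cdf_left \<gamma>1 t > 0 \<and> cdf_left \<gamma>2 t < measure \<gamma>2 UNIV}"

definition le_F :: "real measure \<Rightarrow> real measure \<Rightarrow> bool" where
  "le_F \<gamma>1 \<gamma>2 \<longleftrightarrow>
     le_st \<gamma>1 \<gamma>2 \<and>
     T_plus \<gamma>1 \<gamma>2 \<subseteq> {t. cdf \<gamma>1 t > cdf \<gamma>2 t} \<and>
     T_minus \<gamma>1 \<gamma>2 \<subseteq> {t. cdf_left \<gamma>1 t > cdf_left \<gamma>2 t}"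

(* Sum of a family of Borel measures; see emeasure_sum_measure for its values.
   The sum of the empty family is the zero measure. *)
definition sum_measure :: "'i set \<Rightarrow> ('i \<Rightarrow> 'a::topological_space measure) \<Rightarrow> 'a measure" where
  "sum_measure I \<pi> =
     measure_of UNIV (sets borel) (\<lambda>B. \<integral>\<^sup>+ i. emeasure (\<pi> i) B \<partial>count_space I)"

lemma sets_sum_measure [simp]: "sets (sum_measure I \<pi>) = sets borel"
  unfolding sum_measure_def by (metis sets.sets_measure_of_eq space_borel)

lemma emeasure_sum_measure:
  assumes "\<And>i. i \<in> I \<Longrightarrow> sets (\<pi> i) = sets borel" and B: "B \<in> sets borel"
  shows "emeasure (sum_measure I \<pi>) B = (\<integral>\<^sup>+ i. emeasure (\<pi> i) B \<partial>count_space I)"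
  unfolding sum_measure_def
proof (rule emeasure_measure_of_sigma)
  show "sigma_algebra UNIV (sets (borel :: 'b measure))"
    by (metis sets.sigma_algebra_axioms space_borel)
  show "positive (sets borel) (\<lambda>B. \<integral>\<^sup>+ i. emeasure (\<pi> i) B \<partial>count_space I)"
    by (simp add: positive_def)
  show "countably_additive (sets borel) (\<lambda>B. \<integral>\<^sup>+ i. emeasure (\<pi> i) B \<partial>count_space I)"
  proof (rule countably_additiveI)
    fix A :: "nat \<Rightarrow> 'b set"
    assume A: "range A \<subseteq> sets borel" "disjoint_family A"
    have "(\<Sum>n. \<integral>\<^sup>+ i. emeasure (\<pi> i) (A n) \<partial>count_space I)
        = (\<integral>\<^sup>+ i. (\<Sum>n. emeasure (\<pi> i) (A n)) \<partial>count_space I)"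
      by (rule nn_integral_suminf [symmetric]) simp
    also have "\<dots> = (\<integral>\<^sup>+ i. emeasure (\<pi> i) (\<Union> (range A)) \<partial>count_space I)"
      using A assms(1) by (intro nn_integral_cong suminf_emeasure) auto
    finally show "(\<Sum>n. \<integral>\<^sup>+ i. emeasure (\<pi> i) (A n) \<partial>count_space I)
        = (\<integral>\<^sup>+ i. emeasure (\<pi> i) (\<Union> (range A)) \<partial>count_space I)" .
  qed
qed (rule B)

definition sum_set :: "'i set \<Rightarrow> ('i \<Rightarrow> 'a::topological_space measure set) \<Rightarrow> 'a measure set" where
  "sum_set I E = sum_measure I ` (\<Pi>\<^sub>E i\<in>I. E i)"

(* The assertion that the sum of the E i is direct and that S is this direct sum. *)
definition is_direct_sum ::
  "'a::topological_space measure set \<Rightarrow> 'i set \<Rightarrow> ('i \<Rightarrow> 'a measure set) \<Rightarrow> bool" where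
  "is_direct_sum S I E \<longleftrightarrow> S = sum_set I E \<and> inj_on (sum_measure I) (\<Pi>\<^sub>E i\<in>I. E i)"

end

theory Submission
  imports Defs
begin

text \<open>
  For a plan \<open>\<pi>\<close> put \<open>H t = \<pi> ({..t} \<times> {..t})\<close>. By Tonelli the cost of \<open>\<pi>\<close> is the integral of
  \<open>F\<^sub>\<mu> + F\<^sub>\<nu> - 2 H\<close>, and \<open>H \<le> min F\<^sub>\<mu> F\<^sub>\<nu>\<close> with equality for the monotone plan; as \<open>H\<close> is
  right-continuous, \<open>\<pi>\<close> is optimal iff \<open>H = min F\<^sub>\<mu> F\<^sub>\<nu>\<close> everywhere. Hence an optimal plan moves no
  mass across a point where \<open>F\<^sub>\<mu> = F\<^sub>\<nu>\<close>. Testing countably many such points shows that almost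
  every pair \<open>(x, y)\<close> is either diagonal or spans a segment avoiding \<open>{F\<^sub>\<mu> = F\<^sub>\<nu>}\<close>. So every
  optimal plan splits along any countable partition into sets that are stable under such
  segments, and the marginals of each piece inherit \<open>F\<^sub>\<mu> - F\<^sub>\<nu>\<close> on that piece. Comparing \<open>H\<close>
  shows that the pieces are optimal, and that sums of optimal pieces are.
\<close>

subsection \<open>Transport cost and distribution functions\<close>

lemma M_plusD:
  assumes "M \<in> M_plus"
  shows "sets M = sets borel" "finite_measure M" "space M = UNIV"
  using assms sets_eq_imp_space_eq[of M borel] by (auto simp: M_plus_def)

lemma finite_borel_measure_M_plus: "M \<in> M_plus \<Longrightarrow> finite_borel_measure M"
  by (simp add: M_plus_def finite_borel_measure_def finite_borel_measure_axioms_def)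

lemma sets_Times_borel:
  fixes A B :: "real set"
  assumes "A \<in> sets borel" "B \<in> sets borel"
  shows "A \<times> B \<in> sets borel"
  using assms by (metis borel_prod pair_measureI)

lemma borel_measurable_plan:
  fixes f :: "real \<times> real \<Rightarrow> real"
  assumes "\<pi> \<in> M_plus" "continuous_on UNIV f"
  shows "f \<in> borel_measurable \<pi>"
  using borel_measurable_continuous_onI[OF assms(2)] M_plusD(1)[OF assms(1)]
  by (simp cong: measurable_cong_sets)

lemma emeasure_Marg:
  assumes \<pi>: "\<pi> \<in> Marg \<mu> \<nu>" and B: "B \<in> sets borel"
  shows "emeasure \<pi> (B \<times> UNIV) = emeasure \<mu> B" "emeasure \<pi> (UNIV \<times> B) = emeasure \<nu> B"
proof -
  have P: "\<pi> \<in> M_plus" using \<pi> by (simp add: Marg_def)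
  have "fst \<in> borel_measurable \<pi>" "snd \<in> borel_measurable \<pi>"
    by (auto intro!: borel_measurable_plan[OF P] continuous_intros)
  moreover have "(fst :: real \<times> real \<Rightarrow> real) -` B = B \<times> UNIV"
      "(snd :: real \<times> real \<Rightarrow> real) -` B = UNIV \<times> B"
    by auto
  moreover  have "emeasure \<mu> B = emeasure (distr \<pi> borel fst) B" "emeasure \<nu> B = emeasure (distr \<pi> borel snd) B"
    using \<pi> by (auto simp: Marg_def)
  ultimately show "emeasure \<pi> (B \<times> UNIV) = emeasure \<mu> B" "emeasure \<pi> (UNIV \<times> B) = emeasure \<nu> B"
    using B by (auto simp: emeasure_distr M_plusD[OF P])
qed

lemma measure_Marg:
  assumes \<pi>: "\<pi> \<in> Marg \<mu> \<nu>" and B: "B \<in> sets borel"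
  shows "measure \<pi> (B \<times> UNIV) = measure \<mu> B" "measure \<pi> (UNIV \<times> B) = measure \<nu> B"
  using emeasure_Marg[OF assms] by (auto simp: measure_def)

lemma AE_Marg:
  assumes \<pi>: "\<pi> \<in> Marg \<mu> \<nu>"
  shows "AE x in \<mu>. P x \<Longrightarrow> AE z in \<pi>. P (fst z)" "AE x in \<nu>. P x \<Longrightarrow> AE z in \<pi>. P (snd z)"
proof -
  have P: "\<pi> \<in> M_plus" and m: "\<mu> = distr \<pi> borel fst" "\<nu> = distr \<pi> borel snd"
    using \<pi> by (auto simp: Marg_def)
  have [measurable]: "fst \<in> borel_measurable \<pi>" "snd \<in> borel_measurable \<pi>"
    by (auto intro!: borel_measurable_plan[OF P] continuous_intros)
  show "AE x in \<mu>. P x \<Longrightarrow> AE z in \<pi>. P (fst z)"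
    unfolding m by (rule AE_distrD) measurable
  show "AE x in \<nu>. P x \<Longrightarrow> AE z in \<pi>. P (snd z)"
    unfolding m by (rule AE_distrD) measurable
qed

section \<open>Masses of squares at diagonal points, crossings and the cost of a plan\<close>

definition diag_cdf :: "(real \<times> real) measure \<Rightarrow> real \<Rightarrow> real" where
  "diag_cdf \<pi> t = measure \<pi> ({..t} \<times> {..t})"

text \<open>Both coordinates are at most \<open>t\<close> iff the larger one is. Monotonicity and
  right-continuity thus come from the theory of \<open>cdf\<close>.\<close>

lemma diag_cdf_eq_cdf:
  assumes "\<pi> \<in> M_plus"
  shows "diag_cdf \<pi> = cdf (distr \<pi> borel (\<lambda>z. max (fst z) (snd z)))"
proof
  fix t
  have m: "(\<lambda>z. max (fst z) (snd z)) \<in> measurable \<pi> borel"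
    by (intro borel_measurable_plan[OF assms] continuous_intros)
  show "diag_cdf \<pi> t = cdf (distr \<pi> borel (\<lambda>z. max (fst z) (snd z))) t"
    unfolding diag_cdf_def cdf_def2
    by (subst measure_distr[OF m]) (auto simp: M_plusD[OF assms] intro!: arg_cong[where f="measure \<pi>"])
qed

lemma finite_borel_measure_distr_max:
  assumes "\<pi> \<in> M_plus"
  shows "finite_borel_measure (distr \<pi> borel (\<lambda>z. max (fst z) (snd z)))"
proof -
  have m: "(\<lambda>z. max (fst z) (snd z)) \<in> measurable \<pi> borel"
    by (intro borel_measurable_plan[OF assms] continuous_intros)
  then show ?thesis
    using finite_measure.finite_measure_distr[OF M_plusD(2)[OF assms] m]
    by (simp add: finite_borel_measure_def finite_borel_measure_axioms_def)
qed

lemma continuous_at_right_diag_cdf: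
  "\<pi> \<in> M_plus \<Longrightarrow> continuous (at_right t) (diag_cdf \<pi>)"
  using finite_borel_measure.cdf_is_right_cont[OF finite_borel_measure_distr_max]
  by (simp add: diag_cdf_eq_cdf)

lemma borel_measurable_cdf: "M \<in> M_plus \<Longrightarrow> cdf M \<in> borel_measurable borel"
  by (intro borel_measurable_mono monoI finite_borel_measure.cdf_nondecreasing
      finite_borel_measure_M_plus)

lemma borel_measurable_diag_cdf: "\<pi> \<in> M_plus \<Longrightarrow> diag_cdf \<pi> \<in> borel_measurable borel"
  using finite_borel_measure.cdf_nondecreasing[OF finite_borel_measure_distr_max]
  by (intro borel_measurable_mono monoI) (simp add: diag_cdf_eq_cdf)

text \<open>Each strip over \<open>{..t}\<close> splits at the level \<open>t\<close> into the
  square and a crossing set. The right-hand sides are thus the masses that \<open>\<pi>\<close>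
  moves over \<open>t\<close> to the right and to the left.\<close>

lemma measure_crossing:
  assumes \<pi>: "\<pi> \<in> Marg \<mu> \<nu>"
  shows "measure \<pi> ({..t} \<times> {t<..}) = cdf \<mu> t - diag_cdf \<pi> t"
    and "measure \<pi> ({t<..} \<times> {..t}) = cdf \<nu> t - diag_cdf \<pi> t"
proof -
  have P: "\<pi> \<in> M_plus" using \<pi> by (simp add: Marg_def)
  note S = M_plusD[OF P]
  interpret finite_measure \<pi> by (rule S)
  have "measure \<pi> ({..t} \<times> UNIV) = measure \<pi> ({..t} \<times> {..t}) + measure \<pi> ({..t} \<times> {t<..})"
    by (subst finite_measure_Union[symmetric])
      (auto simp: S intro!: sets_Times_borel arg_cong[where f="measure \<pi>"])
  then show "measure \<pi> ({..t} \<times> {t<..}) = cdf \<mu> t - diag_cdf \<pi> t"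
    by (simp add: measure_Marg[OF \<pi>] cdf_def2 diag_cdf_def)
  have "measure \<pi> (UNIV \<times> {..t}) = measure \<pi> ({..t} \<times> {..t}) + measure \<pi> ({t<..} \<times> {..t})"
    by (subst finite_measure_Union[symmetric])
      (auto simp: S intro!: sets_Times_borel arg_cong[where f="measure \<pi>"])
  then show "measure \<pi> ({t<..} \<times> {..t}) = cdf \<nu> t - diag_cdf \<pi> t"
    by (simp add: measure_Marg[OF \<pi>] cdf_def2 diag_cdf_def)
qed

lemma diag_cdf_le:
  assumes "\<pi> \<in> Marg \<mu> \<nu>"
  shows "diag_cdf \<pi> t \<le> cdf \<mu> t" "diag_cdf \<pi> t \<le> cdf \<nu> t"
  using measure_crossing[OF assms, of t] measure_nonneg[of \<pi> "{..t} \<times> {t<..}"]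
    measure_nonneg[of \<pi> "{t<..} \<times> {..t}"] by auto

text \<open>\<open>\<bar>y - x\<bar>\<close> is the length of the set of levels \<open>t\<close>
  separating \<open>x\<close> from \<open>y\<close>, so Tonelli turns the cost into an integral of
  crossing masses.\<close>

lemma J_eq_nn_integral_cdf:
  assumes \<pi>: "\<pi> \<in> Marg \<mu> \<nu>"
  shows "J \<pi> = (\<integral>\<^sup>+ t. ennreal (cdf \<mu> t + cdf \<nu> t - 2 * diag_cdf \<pi> t) \<partial>lborel)"
proof -
  have P: "\<pi> \<in> M_plus" using \<pi> by (simp add: Marg_def)
  note S = M_plusD[OF P]
  interpret finite_measure \<pi> by (rule S)
  interpret pair_sigma_finite \<pi> lborel ..
  note [measurable_cong] = S(1)[folded borel_prod]
  \<comment> \<open>Pairs separated by the level \<open>t\<close>. The half-open convention is that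
    of \<open>measure_crossing\<close>; the two parts are disjoint, so their masses add.\<close>
  let ?C = "\<lambda>t::real. {..t} \<times> {t<..} \<union> {t<..} \<times> {..t}"
  have len: "ennreal \<bar>y - x\<bar> = (\<integral>\<^sup>+ t. indicator (?C t) (x, y) \<partial>lborel)" for x y :: real
  proof -
    have "(\<integral>\<^sup>+ t. indicator (?C t) (x, y) \<partial>lborel)
        = (\<integral>\<^sup>+ t. indicator ({x..<y} \<union> {y..<x}) t \<partial>lborel)"
      by (intro nn_integral_cong) (auto split: split_indicator)
    also have "\<dots> = emeasure lborel ({x..<y} \<union> {y..<x})"
      by simp
    also have "\<dots> = ennreal \<bar>y - x\<bar>"
      by (cases x y rule: linorder_cases) auto
    finally show ?thesis ..
  qed
  have "J \<pi> = (\<integral>\<^sup>+ z. (\<integral>\<^sup>+ t. indicator (?C t) z \<partial>lborel) \<partial>\<pi>)"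
    unfolding J_def by (intro nn_integral_cong) (auto simp: len)
  also have "\<dots> = (\<integral>\<^sup>+ t. (\<integral>\<^sup>+ z. indicator (?C t) z \<partial>\<pi>) \<partial>lborel)"
  proof (rule Fubini'[symmetric])
    have "(\<lambda>(z, t). indicator (?C t) z :: ennreal) = (\<lambda>w. indicator
        {w. (fst (fst w) \<le> snd w \<and> snd w < snd (fst w)) \<or> (snd w < fst (fst w) \<and> snd (fst w) \<le> snd w)} w)"
      by (auto simp: fun_eq_iff split: split_indicator)
    also have "\<dots> \<in> borel_measurable (\<pi> \<Otimes>\<^sub>M lborel)"
      by measurable
    finally show "(\<lambda>(z, t). indicator (?C t) z :: ennreal) \<in> borel_measurable (\<pi> \<Otimes>\<^sub>M lborel)" .
  qed
  also have "\<dots> = (\<integral>\<^sup>+ t. ennreal (cdf \<mu> t + cdf \<nu> t - 2 * diag_cdf \<pi> t) \<partial>lborel)"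
  proof (rule nn_integral_cong)
    fix t :: real
    have m: "{..t} \<times> {t<..} \<in> sets \<pi>" "{t<..} \<times> {..t} \<in> sets \<pi>"
      by (auto simp: S intro!: sets_Times_borel)
    then have "(\<integral>\<^sup>+ z. indicator (?C t) z \<partial>\<pi>) = emeasure \<pi> (?C t)"
      by (intro nn_integral_indicator) auto
    also have "\<dots> = ennreal (measure \<pi> (?C t))"
      by (rule emeasure_eq_measure)
    also have "measure \<pi> (?C t) = cdf \<mu> t + cdf \<nu> t - 2 * diag_cdf \<pi> t"
      by (subst finite_measure_Union) (use m measure_crossing[OF \<pi>, of t] in auto)
    finally show "(\<integral>\<^sup>+ z. indicator (?C t) z \<partial>\<pi>) = ennreal (cdf \<mu> t + cdf \<nu> t - 2 * diag_cdf \<pi> t)" .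
  qed
  finally show ?thesis .
qed

text \<open>Quantile coupling: Lebesgue measure on the interval from \<open>0\<close> to
  \<open>m\<close> is pushed forward by the pair of pseudo-inverses of the two distribution
  functions. Equal total masses let both use the same parameter interval.\<close>

lemma ex_monotone_plan:
  assumes \<mu>: "\<mu> \<in> M_plus" and \<nu>: "\<nu> \<in> M_plus" and mass: "measure \<mu> UNIV = measure \<nu> UNIV"
  shows "\<exists>\<pi>\<in>Marg \<mu> \<nu>. \<forall>t. diag_cdf \<pi> t = min (cdf \<mu> t) (cdf \<nu> t)"
proof -
  define m where "m = measure \<mu> UNIV"
  interpret M: finite_borel_measure \<mu> by (rule finite_borel_measure_M_plus[OF \<mu>])
  interpret N: finite_borel_measure \<nu> by (rule finite_borel_measure_M_plus[OF \<nu>])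
  interpret F: right_continuous_mono "cdf \<mu>" 0 m
    using M.cdf_lim_at_top by unfold_locales
      (auto intro: M.cdf_is_right_cont M.cdf_lim_at_bot monoI M.cdf_nondecreasing
        simp: m_def M.borel_UNIV)
  interpret G: right_continuous_mono "cdf \<nu>" 0 m
    using N.cdf_lim_at_top by unfold_locales
      (auto intro: N.cdf_is_right_cont N.cdf_lim_at_bot monoI N.cdf_nondecreasing
        simp: m_def mass N.borel_UNIV)
  have bound: "0 \<le> cdf \<mu> t" "cdf \<mu> t \<le> m" "0 \<le> cdf \<nu> t" "cdf \<nu> t \<le> m" for t
    using M.cdf_bounded[of t] N.cdf_bounded[of t]
    by (auto simp: m_def mass M.cdf_nonneg N.cdf_nonneg M.borel_UNIV N.borel_UNIV)
  let ?O = "restrict_space lborel {0<..<m} :: real measure"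
  define T where "T = (\<lambda>\<omega>. (F.I \<omega>, G.I \<omega>))"
  define \<pi> where "\<pi> = distr ?O borel T"
  have [measurable]: "F.I \<in> borel_measurable ?O" "G.I \<in> borel_measurable ?O"
    using borel_measurable_mono_on_fnc[OF F.mono_I] borel_measurable_mono_on_fnc[OF G.mono_I]
    by (simp_all cong: measurable_cong_sets)
  have T [measurable]: "T \<in> measurable ?O borel"
    unfolding T_def borel_prod[symmetric] by measurable
  interpret O: finite_measure ?O
    using measure_nonneg[of \<mu> UNIV]
    by (intro finite_measureI) (simp add: emeasure_restrict_space space_restrict_space m_def)
  have len: "measure ?O {\<omega>\<in>{0<..<m}. \<omega> \<le> c} = c" if "0 \<le> c" "c \<le> m" for c
  proof -
    \<comment> \<open>For \<open>c = m\<close> the endpoint is missing from the open interval; the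
      length is \<open>c\<close> all the same.\<close>
    have "{\<omega>\<in>{0<..<m}. \<omega> \<le> c} = (if c < m then {0<..c} else {0<..<m})"
      using that by auto
    then have "measure lborel {\<omega>\<in>{0<..<m}. \<omega> \<le> c} = c"
      using that by (simp only:) auto
    moreover have "measure ?O {\<omega>\<in>{0<..<m}. \<omega> \<le> c} = measure lborel {\<omega>\<in>{0<..<m}. \<omega> \<le> c}"
      by (subst measure_restrict_space) auto
    ultimately show ?thesis by (rule trans[rotated])
  qed
  have fst: "distr \<pi> borel fst = distr ?O borel F.I"
    unfolding \<pi>_def by (subst distr_distr) (auto simp: T_def comp_def borel_prod[symmetric])
  have snd: "distr \<pi> borel snd = distr ?O borel G.I"
    unfolding \<pi>_def by (subst distr_distr) (auto simp: T_def comp_def borel_prod[symmetric])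
  \<comment> \<open>A pseudo-inverse is at most \<open>t\<close> exactly at the parameters up to
    \<open>cdf \<gamma> t\<close>, which fill an initial interval of that length. This serves both
    marginals.\<close>
  have quantile: "distr ?O borel Q = \<gamma>"
    if \<gamma>: "finite_borel_measure \<gamma>" "\<And>t. 0 \<le> cdf \<gamma> t \<and> cdf \<gamma> t \<le> m"
      and Q: "Q \<in> borel_measurable ?O" "\<And>\<omega> t. 0 < \<omega> \<Longrightarrow> \<omega> < m \<Longrightarrow> \<omega> \<le> cdf \<gamma> t \<longleftrightarrow> Q \<omega> \<le> t"
    for Q \<gamma>
  proof (rule cdf_unique'[OF _ \<gamma>(1)])
    show "finite_borel_measure (distr ?O borel Q)"
      using O.finite_measure_distr[OF Q(1)]
      by (simp add: finite_borel_measure_def finite_borel_measure_axioms_def)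
    show "cdf (distr ?O borel Q) = cdf \<gamma>"
    proof
      fix t
      have "cdf (distr ?O borel Q) t = measure ?O (Q -` {..t} \<inter> {0<..<m})"
        unfolding cdf_def2 by (subst measure_distr[OF Q(1)]) (auto simp: space_restrict_space)
      also have "Q -` {..t} \<inter> {0<..<m} = {\<omega>\<in>{0<..<m}. \<omega> \<le> cdf \<gamma> t}"
        by (auto simp: Q(2)[symmetric])
      also have "measure ?O \<dots> = cdf \<gamma> t"
        using \<gamma>(2) by (intro len) auto
      finally show "cdf (distr ?O borel Q) t = cdf \<gamma> t" .
    qed
  qed
  have "distr ?O borel F.I = \<mu>"
    by (rule quantile[OF M.finite_borel_measure_axioms _ _ F.pseudoinverse]) (simp_all add: bound)
  moreover have "distr ?O borel G.I = \<nu>"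
    by (rule quantile[OF N.finite_borel_measure_axioms _ _ G.pseudoinverse]) (simp_all add: bound)
  moreover have "\<pi> \<in> M_plus"
    using O.finite_measure_distr[OF T] by (simp add: M_plus_def \<pi>_def)
  ultimately have "\<pi> \<in> Marg \<mu> \<nu>"
    by (simp add: Marg_def fst snd)
  moreover have "diag_cdf \<pi> t = min (cdf \<mu> t) (cdf \<nu> t)" for t
  proof -
    have "diag_cdf \<pi> t = measure ?O (T -` ({..t} \<times> {..t}) \<inter> {0<..<m})"
      unfolding diag_cdf_def \<pi>_def
      by (subst measure_distr[OF T]) (auto simp: space_restrict_space intro!: sets_Times_borel)
    \<comment> \<open>By the two Galois connections both coordinates are at most \<open>t\<close>
      iff the parameter is at most both values, hence at most their minimum.\<close>
    also have "T -` ({..t} \<times> {..t}) \<inter> {0<..<m} = {\<omega>\<in>{0<..<m}. \<omega> \<le> min (cdf \<mu> t) (cdf \<nu> t)}"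
      by (auto simp: T_def F.pseudoinverse[symmetric] G.pseudoinverse[symmetric])
    also have "measure ?O \<dots> = min (cdf \<mu> t) (cdf \<nu> t)"
      using bound[of t] by (intro len) auto
    finally show ?thesis .
  qed
  ultimately show ?thesis by blast
qed

text \<open>By right-continuity a nonzero value would persist on some \<open>{t<..<b}\<close>, which
  has positive length.\<close>

lemma AE_lborel_at_right_continuous_eq:
  fixes f :: "real \<Rightarrow> real"
  assumes ae: "AE t in lborel. f t = 0" and cont: "\<And>t. continuous (at_right t) f"
  shows "f t = 0"
proof (rule ccontr)
  assume "f t \<noteq> 0"
  then have "\<forall>\<^sub>F s in at_right t. f s \<noteq> 0"
    using cont[of t] by (auto simp: continuous_within intro: tendsto_imp_eventually_ne)
  then obtain b where b: "t < b" "\<And>s. t < s \<Longrightarrow> s < b \<Longrightarrow> f s \<noteq> 0"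
    by (auto simp: eventually_at_right_field)
  from ae have "AE s in lborel. s \<notin> {t<..<b}"
    by eventually_elim (use b in auto)
  then have "emeasure lborel {t<..<b} = 0"
    by (subst (asm) AE_iff_null_sets[symmetric]) auto
  with b show False by simp
qed

text \<open>Rests on \<open>a + b - 2 * h = \<bar>a - b\<bar> + 2 * (min a b - h)\<close>. The last
  term is nonnegative by \<open>diag_cdf_le\<close>, so the first integral is a lower bound for the
  cost and the second one is the excess over it.\<close>

lemma J_eq_cost_plus_excess:
  assumes \<mu>: "\<mu> \<in> M_plus" and \<nu>: "\<nu> \<in> M_plus" and \<pi>: "\<pi> \<in> Marg \<mu> \<nu>"
  shows "J \<pi> = (\<integral>\<^sup>+ t. ennreal \<bar>cdf \<mu> t - cdf \<nu> t\<bar> \<partial>lborel)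
    + (\<integral>\<^sup>+ t. ennreal (2 * (min (cdf \<mu> t) (cdf \<nu> t) - diag_cdf \<pi> t)) \<partial>lborel)"
proof -
  have P: "\<pi> \<in> M_plus" using \<pi> by (simp add: Marg_def)
  note [measurable] = borel_measurable_cdf[OF \<mu>] borel_measurable_cdf[OF \<nu>]
    borel_measurable_diag_cdf[OF P]
  show ?thesis
    unfolding J_eq_nn_integral_cdf[OF \<pi>]
    by (subst nn_integral_add[symmetric])
      (auto simp: ennreal_plus[symmetric] diag_cdf_le[OF \<pi>] min_def abs_if simp del: ennreal_plus
        intro!: nn_integral_cong arg_cong[where f=ennreal])
qed

text \<open>The monotone plan attains the lower bound \<open>?C\<close>. Since \<open>?C\<close> is
  finite it can be cancelled, so the excess of an optimal plan vanishes: first almost everywhere,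
  then everywhere by right-continuity.\<close>

lemma Opt_iff_diag_cdf:
  assumes \<mu>: "\<mu> \<in> M_plus" and \<nu>: "\<nu> \<in> M_plus" and mass: "measure \<mu> UNIV = measure \<nu> UNIV"
    and fin: "(\<integral>\<^sup>+ t. ennreal \<bar>cdf \<mu> t - cdf \<nu> t\<bar> \<partial>lborel) < \<infinity>" (is "?C < \<infinity>")
  shows "\<pi> \<in> Opt \<mu> \<nu> \<longleftrightarrow> \<pi> \<in> Marg \<mu> \<nu> \<and> (\<forall>t. diag_cdf \<pi> t = min (cdf \<mu> t) (cdf \<nu> t))"
    (is "_ \<longleftrightarrow> _ \<and> ?D \<pi>")
proof (intro iffI conjI)
  note J = J_eq_cost_plus_excess[OF \<mu> \<nu>]
  have JC: "J \<pi>' = ?C" if "\<pi>' \<in> Marg \<mu> \<nu>" "?D \<pi>'" for \<pi>'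
    using J[OF that(1)] that(2) by simp
  {
    assume O: "\<pi> \<in> Opt \<mu> \<nu>"
    then show \<pi>: "\<pi> \<in> Marg \<mu> \<nu>" by (simp add: Opt_def)
    have P: "\<pi> \<in> M_plus" using \<pi> by (simp add: Marg_def)
    note [measurable] = borel_measurable_cdf[OF \<mu>] borel_measurable_cdf[OF \<nu>]
      borel_measurable_diag_cdf[OF P]
    let ?e = "\<lambda>t. min (cdf \<mu> t) (cdf \<nu> t) - diag_cdf \<pi> t"
    obtain \<pi>' where "\<pi>' \<in> Marg \<mu> \<nu>" "?D \<pi>'"
      using ex_monotone_plan[OF \<mu> \<nu> mass] by blast
    with O JC have "J \<pi> \<le> ?C" by (fastforce simp: Opt_def)
    with fin have "(\<integral>\<^sup>+ t. ennreal (2 * ?e t) \<partial>lborel) = 0"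
      using ennreal_add_left_cancel_le[of ?C "\<integral>\<^sup>+ t. ennreal (2 * ?e t) \<partial>lborel" 0]
      unfolding J[OF \<pi>] by auto
    then have "AE t in lborel. ?e t = 0"
      by (subst (asm) nn_integral_0_iff_AE)
        (auto simp: ennreal_eq_0_iff elim!: eventually_mono intro!: antisym diag_cdf_le[OF \<pi>])
    moreover have "continuous (at_right t) ?e" for t
      using \<mu> \<nu> P by (intro continuous_diff continuous_min continuous_at_right_diag_cdf
          finite_borel_measure.cdf_is_right_cont finite_borel_measure_M_plus)
    ultimately have "?e t = 0" for t
      by (rule AE_lborel_at_right_continuous_eq)
    then show "?D \<pi>" by simp
  }
  assume "\<pi> \<in> Marg \<mu> \<nu> \<and> ?D \<pi>"
  then show "\<pi> \<in> Opt \<mu> \<nu>"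
    using JC[of \<pi>] by (auto simp: Opt_def J)
qed

lemma finite_cost_if_INF:
  assumes \<mu>: "\<mu> \<in> M_plus" and \<nu>: "\<nu> \<in> M_plus" and "(INF \<pi>\<in>Marg \<mu> \<nu>. J \<pi>) < \<infinity>"
  shows "(\<integral>\<^sup>+ t. ennreal \<bar>cdf \<mu> t - cdf \<nu> t\<bar> \<partial>lborel) < \<infinity>"
proof -
  obtain \<pi> where "\<pi> \<in> Marg \<mu> \<nu>" "J \<pi> < \<infinity>"
    using assms(3) by (auto simp: INF_less_iff)
  then show ?thesis
    using J_eq_cost_plus_excess[OF \<mu> \<nu>, of \<pi>] by (auto simp: ennreal_add_less_top)
qed

subsection \<open>Restriction of measures and plans\<close>

lemma MargI:
  assumes P: "\<pi> \<in> M_plus" and "sets \<mu> = sets borel" "sets \<nu> = sets borel"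
    and "\<And>B. B \<in> sets borel \<Longrightarrow> emeasure \<pi> (B \<times> UNIV) = emeasure \<mu> B"
    and "\<And>B. B \<in> sets borel \<Longrightarrow> emeasure \<pi> (UNIV \<times> B) = emeasure \<nu> B"
  shows "\<pi> \<in> Marg \<mu> \<nu>"
proof -
  have m: "fst \<in> borel_measurable \<pi>" "snd \<in> borel_measurable \<pi>"
    by (auto intro!: borel_measurable_plan[OF P] continuous_intros)
  have pre: "(fst :: real \<times> real \<Rightarrow> real) -` B = B \<times> UNIV"
      "(snd :: real \<times> real \<Rightarrow> real) -` B = UNIV \<times> B" for B
    by auto
  have "distr \<pi> borel fst = \<mu>" "distr \<pi> borel snd = \<nu>"
    using assms m by (auto intro!: measure_eqI simp: emeasure_distr M_plusD[OF P] pre)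
  with P show ?thesis by (simp add: Marg_def)
qed

lemma restr_in_M_plus:
  assumes "M \<in> M_plus" "A \<in> sets borel"
  shows "restr M A \<in> M_plus"
proof -
  interpret finite_measure M using assms(1) by (rule M_plusD)
  have "emeasure (restr M A) UNIV \<noteq> \<infinity>"
    using assms by (subst emeasure_restr) (auto simp: M_plusD)
  then show ?thesis
    using assms M_plusD(3)[OF assms(1)]
    by (auto simp: M_plus_def restr_def intro!: finite_measureI)
qed

lemma measure_restr:
  assumes "M \<in> M_plus" "A \<in> sets borel" "B \<in> sets borel"
  shows "measure (restr M A) B = measure M (A \<inter> B)"
  using assms by (simp add: measure_def emeasure_restr M_plusD)

lemma atomless_restr:
  assumes "M \<in> M_plus" "A \<in> sets borel" "atomless M"
  shows "atomless (restr M A)"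
proof -
  have "emeasure M (A \<inter> {x}) \<le> emeasure M {x}" for x
    using assms by (intro emeasure_mono) (auto simp: M_plusD)
  with assms show ?thesis
    by (auto simp: atomless_def emeasure_restr M_plusD)
qed

lemma restr_restr:
  assumes "M \<in> M_plus" "A \<in> sets borel" "B \<in> sets borel" "A \<subseteq> B"
  shows "restr (restr M B) A = restr M A"
proof (rule measure_eqI)
  have "B \<inter> (A \<inter> X) = A \<inter> X" for X
    using assms by auto
  then show "emeasure (restr (restr M B) A) X = emeasure (restr M A) X"
    if "X \<in> sets (restr (restr M B) A)" for X
    using assms that by (simp add: emeasure_restr M_plusD)
qed simp

lemma AE_restr:
  assumes "M \<in> M_plus" "A \<in> sets borel"
  shows "AE x in restr M A. x \<in> A"
proof -
  have "- A \<in> null_sets (restr M A)"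
    using assms by (intro null_setsI) (auto simp: emeasure_restr M_plusD)
  then show ?thesis using AE_not_in by fastforce
qed

lemma atomless_cdf:
  assumes "M \<in> M_plus" "atomless M"
  shows "continuous_on UNIV (cdf M)" "cdf_left M t = cdf M t"
proof -
  interpret finite_borel_measure M using assms(1) by (rule finite_borel_measure_M_plus)
  have a: "measure M {x} = 0" for x
    using assms(2) by (simp add: atomless_def measure_def)
  then show "continuous_on UNIV (cdf M)"
    by (simp add: continuous_on_eq_continuous_at isCont_cdf)
  have "{..t} = {..<t} \<union> {t}" by auto
  then show "cdf_left M t = cdf M t"
    unfolding cdf_left_def cdf_def2 using finite_measure_Union[of "{..<t}" "{t}"] a
    by (simp add: sets_M)
qed

text \<open>Without atoms \<open>cdf_left\<close> and \<open>cdf\<close> agree, so one argument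
  covers \<open>T_plus\<close> and \<open>T_minus\<close>: both lie in the interval
  \<open>I\<close>, where the inequality is strict.\<close>

lemma le_F_restr:
  assumes \<mu>: "\<mu> \<in> M_plus" "atomless \<mu>" and \<nu>: "\<nu> \<in> M_plus" "atomless \<nu>"
    and I: "connected I" "I \<in> sets borel" and mass: "measure \<mu> I = measure \<nu> I"
    and inside: "\<And>t. t \<in> I \<Longrightarrow> cdf (restr \<nu> I) t < cdf (restr \<mu> I) t"
    and outside: "\<And>t. t \<notin> I \<Longrightarrow> cdf (restr \<nu> I) t = cdf (restr \<mu> I) t"
  shows "le_F (restr \<mu> I) (restr \<nu> I)"
proof -
  note left = atomless_cdf(2)[OF restr_in_M_plus atomless_restr, OF \<mu>(1) I(2) \<mu>(1) I(2) \<mu>(2)]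
    atomless_cdf(2)[OF restr_in_M_plus atomless_restr, OF \<nu>(1) I(2) \<nu>(1) I(2) \<nu>(2)]
  have "t \<in> I" if "cdf (restr \<mu> I) t > 0" "cdf (restr \<nu> I) t < measure (restr \<nu> I) UNIV" for t
  proof -
    \<comment> \<open>Positive mass up to \<open>t\<close> needs a point of \<open>I\<close> there,
      and missing mass needs one beyond \<open>t\<close>; connectedness then puts \<open>t\<close>
      into \<open>I\<close>.\<close>
    have "I \<inter> {..t} \<noteq> {}"
      using that(1) \<mu> I by (auto simp: cdf_def2 measure_restr)
    moreover have "I \<inter> {..t} \<noteq> I"
      using that(2) \<nu> I by (auto simp: cdf_def2 measure_restr)
    ultimately obtain x y where "x \<in> I" "x \<le> t" "y \<in> I" "\<not> y \<le> t"
      by blast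
    with I(1) show ?thesis
      unfolding connected_iff_interval by fastforce
  qed
  moreover have "cdf (restr \<nu> I) t \<le> cdf (restr \<mu> I) t" for t
    using inside[of t] outside[of t] by (cases "t \<in> I") auto
  ultimately show ?thesis
    using inside mass \<mu> \<nu> I by (auto simp: le_F_def le_st_def T_plus_def T_minus_def left measure_restr)
qed

text \<open>The square treats both coordinates alike. For an optimal plan and a saturated
  \<open>A\<close> it differs from either strip over \<open>A\<close> by a null set only, by
  \<open>AE_both_in\<close>.\<close>

definition restr_plan :: "(real \<times> real) measure \<Rightarrow> real set \<Rightarrow> (real \<times> real) measure" where
  "restr_plan \<pi> A = density \<pi> (indicator (A \<times> A))"

lemma sets_restr_plan [simp]: "sets (restr_plan \<pi> A) = sets \<pi>"
  by (simp add: restr_plan_def)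

lemma emeasure_restr_plan:
  assumes "\<pi> \<in> M_plus" "A \<in> sets borel" "B \<in> sets borel"
  shows "emeasure (restr_plan \<pi> A) B = emeasure \<pi> (A \<times> A \<inter> B)"
  unfolding restr_plan_def
  using assms by (intro emeasure_restricted) (auto simp: M_plusD sets_Times_borel)

lemma restr_plan_in_M_plus:
  assumes "\<pi> \<in> M_plus" "A \<in> sets borel"
  shows "restr_plan \<pi> A \<in> M_plus"
proof -
  interpret finite_measure \<pi> using assms(1) by (rule M_plusD)
  have "emeasure (restr_plan \<pi> A) UNIV \<noteq> \<infinity>"
    using assms by (subst emeasure_restr_plan) auto
  then show ?thesis
    using assms M_plusD(3)[OF assms(1)]
    by (auto simp: M_plus_def restr_plan_def intro!: finite_measureI)
qed

subsection \<open>Separating points and saturated sets\<close>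

text \<open>Lets a closed set, possibly uncountable, be tested at countably many points, so that
  null sets can be united. The points are those of \<open>Z\<close> nearest to each rational on its
  right and on its left.\<close>

lemma countable_crossing_set:
  fixes Z :: "real set"
  assumes Z: "closed Z"
  obtains D where "countable D" "D \<subseteq> Z"
    "\<And>x y z. x < y \<Longrightarrow> z \<in> Z \<Longrightarrow> x \<le> z \<Longrightarrow> z \<le> y \<Longrightarrow> \<exists>d\<in>D. x \<le> d \<and> d \<le> y"
proof
  \<comment> \<open>The intersection with \<open>Z\<close> matters where no point of
    \<open>Z\<close> lies beyond \<open>r\<close>: \<open>Inf\<close> or \<open>Sup\<close> of the
    empty set may fall outside \<open>Z\<close>.\<close>
  let ?D = "Z \<inter> ((\<lambda>r. Inf (Z \<inter> {r..})) ` \<rat> \<union> (\<lambda>r. Sup (Z \<inter> {..r})) ` \<rat>)"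
  show "countable ?D" using countable_rat by blast
  show "?D \<subseteq> Z" by blast
  fix x y z :: real
  assume "x < y" and z: "z \<in> Z" "x \<le> z" "z \<le> y"
  \<comment> \<open>As \<open>x < y\<close>, at least one side of \<open>z\<close> leaves room for a
    rational inside the segment.\<close>
  then consider "x < z" | "z < y" by linarith
  then show "\<exists>d\<in>?D. x \<le> d \<and> d \<le> y"
  proof cases
    case 1
    then obtain r where r: "r \<in> \<rat>" "x < r" "r < z" using Rats_dense_in_real by blast
    have b: "bdd_below (Z \<inter> {r..})" by (intro bdd_belowI[of _ r]) auto
    have "Inf (Z \<inter> {r..}) \<in> Z \<inter> {r..}"
      using r z Z b by (intro closed_contains_Inf) (auto intro: closed_Int)
    moreover have "Inf (Z \<inter> {r..}) \<le> z"
      using r z b by (intro cInf_lower) auto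
    ultimately show ?thesis
      using r z by (intro bexI[of _ "Inf (Z \<inter> {r..})"]) auto
  next
    case 2
    then obtain r where r: "r \<in> \<rat>" "z < r" "r < y" using Rats_dense_in_real by blast
    have b: "bdd_above (Z \<inter> {..r})" by (intro bdd_aboveI[of _ r]) auto
    have "Sup (Z \<inter> {..r}) \<in> Z \<inter> {..r}"
      using r z Z b by (intro closed_contains_Sup) (auto intro: closed_Int)
    moreover have "z \<le> Sup (Z \<inter> {..r})"
      using r z b by (intro cSup_upper) auto
    ultimately show ?thesis
      using r z by (intro bexI[of _ "Sup (Z \<inter> {..r})"]) auto
  qed
qed

text \<open>
  In the application \<open>Z\<close> is the set where the two distribution functions agree, and the
  condition says that \<open>A\<close> is a union of components of \<open>- Z\<close> together with any part of \<open>Z\<close>.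
\<close>
definition saturated :: "real set \<Rightarrow> real set \<Rightarrow> bool" where
  "saturated Z A \<longleftrightarrow> (\<forall>x\<in>A. \<forall>y. closed_segment x y \<inter> Z = {} \<longrightarrow> y \<in> A)"

lemma saturatedD: "saturated Z A \<Longrightarrow> x \<in> A \<Longrightarrow> closed_segment x y \<inter> Z = {} \<Longrightarrow> y \<in> A"
  by (auto simp: saturated_def)

lemma closed_segment_initial:
  fixes x y t :: real
  shows "t \<in> closed_segment x y \<Longrightarrow> closed_segment x t \<subseteq> closed_segment x y"
  by (simp add: subset_closed_segment)

text \<open>A segment that starts in \<open>C\<close> and avoids \<open>Z\<close> stays in
  \<open>U\<close>, by saturation applied to its initial parts. Being connected, it then lies in the
  component where it starts.\<close>

lemma saturated_component:
  assumes U: "saturated Z U" and C: "C \<in> components U"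
  shows "saturated Z C"
  unfolding saturated_def
proof (intro ballI allI impI)
  fix x y assume x: "x \<in> C" and xy: "closed_segment x y \<inter> Z = {}"
  have "closed_segment x y \<subseteq> U"
    using saturatedD[OF U, of x] x xy in_components_subset[OF C] closed_segment_initial by blast
  then have "closed_segment x y \<subseteq> C"
    using x C by (intro components_maximal[OF C]) auto
  then show "y \<in> C" by auto
qed

text \<open>A segment avoiding \<open>Z\<close> is covered by two disjoint open sets, and
  connectedness keeps it in the one where it starts.\<close>

lemma saturated_open_part:
  assumes U: "open U" "open V" "U \<inter> V = {}" "- Z \<subseteq> U \<union> V"
  shows "saturated Z U"
  unfolding saturated_def
proof (intro ballI allI impI)
  fix x y assume x: "x \<in> U" and xy: "closed_segment x y \<inter> Z = {}"
  then have "closed_segment x y \<subseteq> U \<union> V" using U by blast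
  then have "V \<inter> closed_segment x y = {}"
    using connectedD[OF connected_segment(1) U(1,2), of x y] x U(3) by auto
  then show "y \<in> U"
    using \<open>closed_segment x y \<subseteq> U \<union> V\<close> ends_in_segment(2)[of y x] by blast
qed

subsection \<open>Optimal plans of an atomless pair\<close>

text \<open>\<open>finite_cost\<close> is stated with distribution functions because this form
  passes to restrictions by a pointwise bound; \<open>finite_cost_if_INF\<close> supplies it
  initially.\<close>

locale atomless_pair =
  fixes \<mu> \<nu> :: "real measure"
  assumes \<mu>: "\<mu> \<in> M_plus" and \<nu>: "\<nu> \<in> M_plus"
    and atomless_\<mu>: "atomless \<mu>" and atomless_\<nu>: "atomless \<nu>"
    and mass: "measure \<mu> UNIV = measure \<nu> UNIV"
    and finite_cost: "(\<integral>\<^sup>+ t. ennreal \<bar>cdf \<mu> t - cdf \<nu> t\<bar> \<partial>lborel) < \<infinity>"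
begin

abbreviation Z :: "real set" where
  "Z \<equiv> {x. cdf \<mu> x = cdf \<nu> x}"

lemma closed_Z: "closed Z"
  by (intro closed_Collect_eq atomless_cdf \<mu> \<nu> atomless_\<mu> atomless_\<nu>)

lemma Opt_iff: "\<pi> \<in> Opt \<mu> \<nu> \<longleftrightarrow> \<pi> \<in> Marg \<mu> \<nu> \<and> (\<forall>t. diag_cdf \<pi> t = min (cdf \<mu> t) (cdf \<nu> t))"
  by (rule Opt_iff_diag_cdf[OF \<mu> \<nu> mass finite_cost])

lemma ex_Opt: "\<exists>\<pi>. \<pi> \<in> Opt \<mu> \<nu>"
  using ex_monotone_plan[OF \<mu> \<nu> mass] by (auto simp: Opt_iff)

text \<open>At a point of \<open>Z\<close> both crossing masses vanish, by \<open>Opt_iff\<close>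
  and \<open>measure_crossing\<close>. Collecting this over the countable set \<open>D\<close>
  yields a single null set.\<close>

lemma AE_Opt_segment:
  assumes O: "\<pi> \<in> Opt \<mu> \<nu>"
  shows "AE z in \<pi>. fst z = snd z \<or> closed_segment (fst z) (snd z) \<inter> Z = {}"
proof -
  have \<pi>: "\<pi> \<in> Marg \<mu> \<nu>" and diag: "diag_cdf \<pi> t = min (cdf \<mu> t) (cdf \<nu> t)" for t
    using O by (auto simp: Opt_iff)
  have P: "\<pi> \<in> M_plus" using \<pi> by (simp add: Marg_def)
  interpret finite_measure \<pi> using P by (rule M_plusD)
  obtain D where D: "countable D" "D \<subseteq> Z"
    "\<And>x y z. x < y \<Longrightarrow> z \<in> Z \<Longrightarrow> x \<le> z \<Longrightarrow> z \<le> y \<Longrightarrow> \<exists>d\<in>D. x \<le> d \<and> d \<le> y"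
    using countable_crossing_set[OF closed_Z] by blast
  have "AE z in \<pi>. d \<notin> closed_segment (fst z) (snd z)" if "d \<in> D" for d
  proof -
    have "cdf \<mu> d = cdf \<nu> d" using D(2) that by blast
    then have "{..d} \<times> {d<..} \<in> null_sets \<pi>" "{d<..} \<times> {..d} \<in> null_sets \<pi>"
      using measure_crossing[OF \<pi>, of d]
      by (auto intro!: null_setsI sets_Times_borel simp: M_plusD[OF P] emeasure_eq_measure diag)
    \<comment> \<open>The crossing sets leave out segments that touch \<open>d\<close> with their
      larger endpoint only, and the degenerate one at \<open>d\<close>. The absence of atoms
      excludes these.\<close>
    moreover have "{d} \<in> null_sets \<mu>" "{d} \<in> null_sets \<nu>"
      using atomless_\<mu> atomless_\<nu> \<mu> \<nu> by (auto simp: atomless_def M_plusD)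
    ultimately have "AE z in \<pi>. z \<notin> {..d} \<times> {d<..}" "AE z in \<pi>. z \<notin> {d<..} \<times> {..d}"
        "AE z in \<pi>. fst z \<notin> {d}" "AE z in \<pi>. snd z \<notin> {d}"
      by (blast intro: AE_not_in AE_Marg[OF \<pi> AE_not_in])+
    then show ?thesis
      by eventually_elim (auto simp: closed_segment_eq_real_ivl split: if_splits)
  qed
  then have "AE z in \<pi>. \<forall>d\<in>D. d \<notin> closed_segment (fst z) (snd z)"
    using D(1) by (intro AE_ball_countable')
  then show ?thesis
  proof eventually_elim
    fix z
    assume no: "\<forall>d\<in>D. d \<notin> closed_segment (fst z) (snd z)"
    \<comment> \<open>A point of \<open>Z\<close> on a nondegenerate segment forces a point of
      \<open>D\<close> on it; the cases are the two orientations.\<close>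
    have False if "c \<in> Z" "c \<in> closed_segment (fst z) (snd z)" "fst z \<noteq> snd z" for c
    proof (cases "fst z < snd z")
      case True
      then show False
        using D(3)[OF True that(1)] no that by (auto simp: closed_segment_eq_real_ivl)
    next
      case False
      then have "snd z < fst z" using that by simp
      then show False
        using D(3)[OF _ that(1)] no that by (fastforce simp: closed_segment_eq_real_ivl)
    qed
    then show "fst z = snd z \<or> closed_segment (fst z) (snd z) \<inter> Z = {}"
      by blast
  qed
qed

text \<open>A diagonal pair is trivial. Otherwise every subsegment avoids \<open>Z\<close> too, and
  saturation passes membership in \<open>A\<close> along it in both directions.\<close>

lemma AE_Opt_saturated:
  assumes O: "\<pi> \<in> Opt \<mu> \<nu>" and A: "saturated Z A"
  shows "AE z in \<pi>. \<forall>t\<in>closed_segment (fst z) (snd z).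
    (fst z \<in> A \<longleftrightarrow> t \<in> A) \<and> (snd z \<in> A \<longleftrightarrow> t \<in> A)"
  using AE_Opt_segment[OF O]
proof eventually_elim
  fix z :: "real \<times> real"
  assume z: "fst z = snd z \<or> closed_segment (fst z) (snd z) \<inter> Z = {}"
  have sub: "u \<in> A \<longleftrightarrow> v \<in> A" if "closed_segment u v \<subseteq> closed_segment (fst z) (snd z)"
      "closed_segment (fst z) (snd z) \<inter> Z = {}" for u v
  proof -
    have "closed_segment u v \<inter> Z = {}" "closed_segment v u \<inter> Z = {}"
      using that closed_segment_commute[of u v] by blast+
    then show ?thesis using saturatedD[OF A] by metis
  qed
  have "(fst z \<in> A \<longleftrightarrow> t \<in> A) \<and> (snd z \<in> A \<longleftrightarrow> t \<in> A)"
    if t: "t \<in> closed_segment (fst z) (snd z)" for t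
    using z
  proof
    assume "fst z = snd z"
    then show ?thesis using t by simp
  next
    assume e: "closed_segment (fst z) (snd z) \<inter> Z = {}"
    then show ?thesis
      using t by (intro conjI sub) (auto simp: subset_closed_segment simp del: Int_Collect)
  qed
  then show "\<forall>t\<in>closed_segment (fst z) (snd z). (fst z \<in> A \<longleftrightarrow> t \<in> A) \<and> (snd z \<in> A \<longleftrightarrow> t \<in> A)"
    by blast
qed

section \<open>Restriction of an optimal plan to a saturated Borel set\<close>

context
  fixes \<pi> A
  assumes O: "\<pi> \<in> Opt \<mu> \<nu>" and A: "A \<in> sets borel" "saturated Z A"
begin

lemma Opt_in_Marg: "\<pi> \<in> Marg \<mu> \<nu>"
  using O by (simp add: Opt_iff)

lemma Opt_in_M_plus: "\<pi> \<in> M_plus"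
  using Opt_in_Marg by (simp add: Marg_def)

lemma AE_both_in: "AE z in \<pi>. fst z \<in> A \<longleftrightarrow> snd z \<in> A"
  using AE_Opt_saturated[OF O A(2)] by eventually_elim auto

text \<open>By \<open>AE_both_in\<close> the square \<open>A \<times> A\<close> agrees up to a null
  set with each of the strips \<open>A \<times> UNIV\<close> and
  \<open>UNIV \<times> A\<close>.\<close>

lemma restr_plan_in_Marg: "restr_plan \<pi> A \<in> Marg (restr \<mu> A) (restr \<nu> A)"
proof (rule MargI)
  show "restr_plan \<pi> A \<in> M_plus"
    by (rule restr_plan_in_M_plus[OF Opt_in_M_plus A(1)])
  note M = M_plusD(1)[OF Opt_in_M_plus]
  fix B :: "real set"
  assume B: "B \<in> sets borel"
  have "emeasure (restr_plan \<pi> A) (B \<times> UNIV) = emeasure \<pi> (A \<times> A \<inter> B \<times> UNIV)"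
    using B by (simp add: emeasure_restr_plan[OF Opt_in_M_plus A(1)] sets_Times_borel)
  also have "\<dots> = emeasure \<pi> ((A \<inter> B) \<times> UNIV)"
    using B A(1) AE_both_in
    by (intro emeasure_eq_AE) (auto simp: M intro!: sets_Times_borel sets.Int)
  finally show "emeasure (restr_plan \<pi> A) (B \<times> UNIV) = emeasure (restr \<mu> A) B"
    using A B by (simp add: emeasure_Marg[OF Opt_in_Marg] emeasure_restr M_plusD[OF \<mu>])
  have "emeasure (restr_plan \<pi> A) (UNIV \<times> B) = emeasure \<pi> (A \<times> A \<inter> UNIV \<times> B)"
    using B by (simp add: emeasure_restr_plan[OF Opt_in_M_plus A(1)] sets_Times_borel)
  also have "\<dots> = emeasure \<pi> (UNIV \<times> (A \<inter> B))"
    using B A(1) AE_both_in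
    by (intro emeasure_eq_AE) (auto simp: M intro!: sets_Times_borel sets.Int)
  finally show "emeasure (restr_plan \<pi> A) (UNIV \<times> B) = emeasure (restr \<nu> A) B"
    using A B by (simp add: emeasure_Marg[OF Opt_in_Marg] emeasure_restr M_plusD[OF \<nu>])
qed (simp_all add: M_plusD[OF \<mu>] M_plusD[OF \<nu>])

text \<open>For almost every pair whose segment contains \<open>t\<close>, membership of
  \<open>t\<close> in \<open>A\<close> decides that of both coordinates. Meant for the two crossing
  sets at \<open>t\<close>.\<close>

lemma measure_restr_plan_crossing:
  assumes B: "B \<in> sets borel" and seg: "\<And>z. z \<in> B \<Longrightarrow> t \<in> closed_segment (fst z) (snd z)"
  shows "measure (restr_plan \<pi> A) B = (if t \<in> A then measure \<pi> B else 0)"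
proof -
  note M = M_plusD(1)[OF Opt_in_M_plus]
  have AB: "A \<times> A \<inter> B \<in> sets \<pi>"
    using A B by (auto simp: M intro!: sets.Int sets_Times_borel)
  have "emeasure (restr_plan \<pi> A) B = emeasure \<pi> (A \<times> A \<inter> B)"
    by (rule emeasure_restr_plan[OF Opt_in_M_plus A(1) B])
  also have "\<dots> = emeasure \<pi> (if t \<in> A then B else {})"
    using AE_Opt_saturated[OF O A(2)]
  proof (intro emeasure_eq_AE, eventually_elim)
    fix z
    assume "\<forall>t\<in>closed_segment (fst z) (snd z). (fst z \<in> A \<longleftrightarrow> t \<in> A) \<and> (snd z \<in> A \<longleftrightarrow> t \<in> A)"
    then show "z \<in> A \<times> A \<inter> B \<longleftrightarrow> z \<in> (if t \<in> A then B else {})"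
      using seg[of z] by (auto simp: mem_Times_iff)
  qed (use AB B M in auto)
  finally show ?thesis
    by (simp add: measure_def)
qed

text \<open>The left-hand sides are crossing masses of the restricted plan, so restriction keeps all
  the mass moved over \<open>t\<close> or none of it.\<close>

lemma cdf_restr_minus_diag_cdf:
  "cdf (restr \<mu> A) t - diag_cdf (restr_plan \<pi> A) t
    = (if t \<in> A then cdf \<mu> t - diag_cdf \<pi> t else 0)"
  "cdf (restr \<nu> A) t - diag_cdf (restr_plan \<pi> A) t
    = (if t \<in> A then cdf \<nu> t - diag_cdf \<pi> t else 0)"
  unfolding measure_crossing[OF restr_plan_in_Marg, symmetric]
    measure_crossing[OF Opt_in_Marg, symmetric]
  by (rule measure_restr_plan_crossing;
      auto simp: closed_segment_eq_real_ivl intro!: sets_Times_borel)+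

text \<open>The diagonal terms cancel, which leaves an identity free of \<open>\<pi>\<close>. It
  yields the order on components, the equality on \<open>Z\<close> and the finite cost of the
  pieces.\<close>

lemma cdf_restr_diff:
  "cdf (restr \<mu> A) t - cdf (restr \<nu> A) t = (if t \<in> A then cdf \<mu> t - cdf \<nu> t else 0)"
  using cdf_restr_minus_diag_cdf[of t] by (auto split: if_splits)

text \<open>Off \<open>A\<close> both differences vanish; on \<open>A\<close> they are those of
  \<open>\<pi>\<close>, the smaller of which is zero by optimality.\<close>

lemma diag_cdf_restr_plan:
  "diag_cdf (restr_plan \<pi> A) t = min (cdf (restr \<mu> A) t) (cdf (restr \<nu> A) t)"
  using cdf_restr_minus_diag_cdf[of t] O
  by (auto simp: Opt_iff min_def split: if_splits)

lemma measure_saturated: "measure \<mu> A = measure \<nu> A"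
  using measure_Marg[OF restr_plan_in_Marg, of UNIV] A(1)
  by (simp add: measure_restr \<mu> \<nu>)

lemma atomless_pair_restr: "atomless_pair (restr \<mu> A) (restr \<nu> A)"
proof
  show "measure (restr \<mu> A) UNIV = measure (restr \<nu> A) UNIV"
    using A(1) measure_saturated by (simp add: measure_restr \<mu> \<nu>)
  have "(\<integral>\<^sup>+ t. ennreal \<bar>cdf (restr \<mu> A) t - cdf (restr \<nu> A) t\<bar> \<partial>lborel)
      \<le> (\<integral>\<^sup>+ t. ennreal \<bar>cdf \<mu> t - cdf \<nu> t\<bar> \<partial>lborel)"
    by (intro nn_integral_mono) (simp add: cdf_restr_diff)
  then show "(\<integral>\<^sup>+ t. ennreal \<bar>cdf (restr \<mu> A) t - cdf (restr \<nu> A) t\<bar> \<partial>lborel) < \<infinity>"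
    using finite_cost by (rule le_less_trans)
qed (use A(1) in \<open>auto intro: restr_in_M_plus atomless_restr \<mu> \<nu> atomless_\<mu> atomless_\<nu>\<close>)

lemma restr_plan_in_Opt: "restr_plan \<pi> A \<in> Opt (restr \<mu> A) (restr \<nu> A)"
  using atomless_pair.Opt_iff[OF atomless_pair_restr] restr_plan_in_Marg diag_cdf_restr_plan
  by blast

end

end

subsection \<open>Direct sum decomposition\<close>

lemma sum_measure_cong:
  assumes "\<And>i. i \<in> I \<Longrightarrow> f i = g i"
  shows "sum_measure I f = sum_measure I g"
  unfolding sum_measure_def
  by (intro arg_cong[where f="measure_of UNIV (sets borel)"] ext nn_integral_cong) (simp add: assms)

lemma is_direct_sum_cong:
  assumes "\<And>i. i \<in> I \<Longrightarrow> E i = F i"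
  shows "is_direct_sum S I E \<longleftrightarrow> is_direct_sum S I F"
  by (simp add: is_direct_sum_def sum_set_def PiE_cong[OF assms] cong: PiE_cong)

lemma emeasure_countable_partition:
  assumes "countable I" "disjoint_family_on X I" "\<And>i. i \<in> I \<Longrightarrow> X i \<in> sets M" "B \<in> sets M"
    and ae: "AE x in M. x \<in> (\<Union>i\<in>I. X i)"
  shows "(\<integral>\<^sup>+ i. emeasure M (X i \<inter> B) \<partial>count_space I) = emeasure M B"
proof -
  have "emeasure M (\<Union>i\<in>I. X i \<inter> B) = (\<integral>\<^sup>+ i. emeasure M (X i \<inter> B) \<partial>count_space I)"
    using assms by (intro emeasure_UN_countable) (auto simp: disjoint_family_on_def)
  moreover have "emeasure M (\<Union>i\<in>I. X i \<inter> B) = emeasure M B"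
    using ae
  proof (intro emeasure_eq_AE, eventually_elim)
    show "(\<Union>i\<in>I. X i \<inter> B) \<in> sets M"
      using assms by (intro sets.countable_UN') auto
  qed (use assms in auto)
  ultimately show ?thesis by simp
qed

text \<open>Summand \<open>i\<close> can be read off from the sum: the other summands give no mass
  to \<open>A i \<times> A i\<close>, as their marginals live on sets disjoint from
  \<open>A i\<close>.\<close>

lemma inj_on_sum_measure_Marg:
  assumes A: "\<And>i. i \<in> I \<Longrightarrow> A i \<in> sets borel" "disjoint_family_on A I"
    and \<mu>: "\<mu> \<in> M_plus" and \<nu>: "\<nu> \<in> M_plus"
    and E: "\<And>i. i \<in> I \<Longrightarrow> E i \<subseteq> Marg (restr \<mu> (A i)) (restr \<nu> (A i))"
  shows "inj_on (sum_measure I) (\<Pi>\<^sub>E i\<in>I. E i)"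
proof -
  have rec: "emeasure (sum_measure I \<sigma>) (A i \<times> A i \<inter> B) = emeasure (\<sigma> i) B"
    if \<sigma>: "\<sigma> \<in> (\<Pi>\<^sub>E i\<in>I. E i)" and i: "i \<in> I" and B: "B \<in> sets borel" for \<sigma> i B
  proof -
    have M: "\<sigma> j \<in> Marg (restr \<mu> (A j)) (restr \<nu> (A j))" if "j \<in> I" for j
      using \<sigma> E that by (auto simp: PiE_iff)
    have S: "sets (\<sigma> j) = sets borel" if "j \<in> I" for j
      using M[OF that] M_plusD(1) by (auto simp: Marg_def)
    have AB: "A i \<times> A i \<inter> B \<in> sets borel"
      using A i B by (intro sets.Int sets_Times_borel) auto
    have in_A: "AE z in \<sigma> j. z \<in> A j \<times> A j" if "j \<in> I" for j
    proof -
      have "AE z in \<sigma> j. fst z \<in> A j" "AE z in \<sigma> j. snd z \<in> A j"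
        using A that by (auto intro!: AE_Marg[OF M[OF that]] AE_restr \<mu> \<nu>)
      then show ?thesis by eventually_elim (auto simp: mem_Times_iff)
    qed
    have "emeasure (\<sigma> j) (A i \<times> A i \<inter> B) = 0" if "j \<in> I" "j \<noteq> i" for j
    proof -
      have "A i \<inter> A j = {}"
        using A(2) i that by (auto simp: disjoint_family_on_def)
      then have "AE z in \<sigma> j. z \<in> A i \<times> A i \<inter> B \<longleftrightarrow> z \<in> {}"
        by (intro eventually_mono[OF in_A[OF that(1)]]) auto
      then have "emeasure (\<sigma> j) (A i \<times> A i \<inter> B) = emeasure (\<sigma> j) {}"
        using AB S that by (intro emeasure_eq_AE) auto
      then show ?thesis by simp
    qed
    then have "(\<integral>\<^sup>+ j. emeasure (\<sigma> j) (A i \<times> A i \<inter> B) \<partial>count_space I)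
        = (\<Sum>j\<in>{i}. emeasure (\<sigma> j) (A i \<times> A i \<inter> B))"
      using i by (intro nn_integral_count_space') auto
    also have "\<dots> = emeasure (\<sigma> i) B"
      using in_A[OF i] AB B S[OF i] by (auto intro!: emeasure_eq_AE)
    finally show ?thesis
      using AB S by (simp add: emeasure_sum_measure)
  qed
  show ?thesis
  proof (rule inj_onI)
    fix \<sigma> \<tau>
    assume \<sigma>: "\<sigma> \<in> (\<Pi>\<^sub>E i\<in>I. E i)" and \<tau>: "\<tau> \<in> (\<Pi>\<^sub>E i\<in>I. E i)"
      and eq: "sum_measure I \<sigma> = sum_measure I \<tau>"
    show "\<sigma> = \<tau>"
    proof (rule PiE_ext[OF \<sigma> \<tau>])
      fix i assume i: "i \<in> I"
      have S: "sets (\<sigma> i) = sets borel" "sets (\<tau> i) = sets borel"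
        using \<sigma> \<tau> E[OF i] i M_plusD(1) by (fastforce simp: PiE_iff Marg_def)+
      show "\<sigma> i = \<tau> i"
        using rec[OF \<sigma> i] rec[OF \<tau> i] S by (intro measure_eqI) (auto simp: eq)
    qed
  qed
qed

section \<open>Splitting and gluing of optimal plans\<close>

context atomless_pair
begin

text \<open>The cover is asked for up to null sets, so that the result also applies to measures
  restricted to an open set and to the components of that set.\<close>

theorem is_direct_sum_Opt:
  assumes I: "countable I"
    and A: "\<And>i. i \<in> I \<Longrightarrow> A i \<in> sets borel" "\<And>i. i \<in> I \<Longrightarrow> saturated Z (A i)"
    and disj: "disjoint_family_on A I"
    and cover: "AE x in \<mu>. x \<in> (\<Union>i\<in>I. A i)" "AE x in \<nu>. x \<in> (\<Union>i\<in>I. A i)"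
  shows "is_direct_sum (Opt \<mu> \<nu>) I (\<lambda>i. Opt (restr \<mu> (A i)) (restr \<nu> (A i)))"
proof -
  let ?E = "\<lambda>i. Opt (restr \<mu> (A i)) (restr \<nu> (A i))"
  have EM: "?E i \<subseteq> Marg (restr \<mu> (A i)) (restr \<nu> (A i))" for i
    by (auto simp: Opt_def)
  \<comment> \<open>Countability of \<open>I\<close> merges the exceptional sets of
    \<open>AE_both_in\<close>; the cover then places almost every pair in some square
    \<open>A i \<times> A i\<close>.\<close>
  have split: "sum_measure I (\<lambda>i. restr_plan \<pi> (A i)) = \<pi>" if O: "\<pi> \<in> Opt \<mu> \<nu>" for \<pi>
  proof (rule measure_eqI)
    have \<pi>: "\<pi> \<in> Marg \<mu> \<nu>" and P: "\<pi> \<in> M_plus"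
      using O by (auto simp: Opt_def Marg_def)
    note S = M_plusD(1)[OF P]
    show "sets (sum_measure I (\<lambda>i. restr_plan \<pi> (A i))) = sets \<pi>"
      by (simp add: S)
    fix B assume "B \<in> sets (sum_measure I (\<lambda>i. restr_plan \<pi> (A i)))"
    then have B: "B \<in> sets borel" by simp
    have "AE z in \<pi>. \<forall>i\<in>I. fst z \<in> A i \<longleftrightarrow> snd z \<in> A i"
      using AE_both_in[OF O] A I by (intro AE_ball_countable') auto
    moreover have "AE z in \<pi>. fst z \<in> (\<Union>i\<in>I. A i)"
      by (rule AE_Marg(1)[OF \<pi> cover(1)])
    ultimately have ae: "AE z in \<pi>. z \<in> (\<Union>i\<in>I. A i \<times> A i)"
      by eventually_elim (auto simp: mem_Times_iff)
    have "emeasure (sum_measure I (\<lambda>i. restr_plan \<pi> (A i))) B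
        = (\<integral>\<^sup>+ i. emeasure (restr_plan \<pi> (A i)) B \<partial>count_space I)"
      using B S by (intro emeasure_sum_measure) auto
    also have "\<dots> = (\<integral>\<^sup>+ i. emeasure \<pi> (A i \<times> A i \<inter> B) \<partial>count_space I)"
      using A B P by (intro nn_integral_cong) (simp add: emeasure_restr_plan)
    also have "\<dots> = emeasure \<pi> B"
      using disj A B S by (intro emeasure_countable_partition[OF I _ _ _ ae])
        (auto simp: disjoint_family_on_def intro!: sets_Times_borel)
    finally show "emeasure (sum_measure I (\<lambda>i. restr_plan \<pi> (A i))) B = emeasure \<pi> B" .
  qed
  have sub: "Opt \<mu> \<nu> \<subseteq> sum_set I ?E"
  proof
    fix \<pi> assume O: "\<pi> \<in> Opt \<mu> \<nu>"
    \<comment> \<open>\<open>restrict\<close> makes the family \<open>undefined\<close> off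
      \<open>I\<close>, as membership in \<open>\<Pi>\<^sub>E\<close> demands.\<close>
    have "\<pi> = sum_measure I (restrict (\<lambda>i. restr_plan \<pi> (A i)) I)"
      using split[OF O] by (simp cong: sum_measure_cong)
    moreover have "restrict (\<lambda>i. restr_plan \<pi> (A i)) I \<in> (\<Pi>\<^sub>E i\<in>I. ?E i)"
      using restr_plan_in_Opt[OF O] A by auto
    ultimately show "\<pi> \<in> sum_set I ?E"
      unfolding sum_set_def by blast
  qed
  have sup: "sum_measure I \<sigma> \<in> Opt \<mu> \<nu>" if "\<sigma> \<in> (\<Pi>\<^sub>E i\<in>I. ?E i)" for \<sigma>
  proof -
    let ?S = "sum_measure I \<sigma>"
    have OE: "\<sigma> i \<in> ?E i" and M: "\<sigma> i \<in> Marg (restr \<mu> (A i)) (restr \<nu> (A i))" if "i \<in> I" for i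
      using \<open>\<sigma> \<in> _\<close> that EM by (auto simp: PiE_iff)
    have P: "\<sigma> i \<in> M_plus" if "i \<in> I" for i
      using M[OF that] by (auto simp: Marg_def)
    have em: "emeasure ?S B = (\<integral>\<^sup>+ i. emeasure (\<sigma> i) B \<partial>count_space I)" if "B \<in> sets borel" for B
      using that P by (intro emeasure_sum_measure) (auto simp: M_plusD)
    have marg: "emeasure ?S (B \<times> UNIV) = emeasure \<mu> B" "emeasure ?S (UNIV \<times> B) = emeasure \<nu> B"
      if B: "B \<in> sets borel" for B
    proof -
      have "emeasure ?S (B \<times> UNIV) = (\<integral>\<^sup>+ i. emeasure \<mu> (A i \<inter> B) \<partial>count_space I)"
        using B A(1) by (auto simp: em sets_Times_borel emeasure_Marg[OF M] emeasure_restr M_plusD[OF \<mu>]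
            intro!: nn_integral_cong)
      also have "\<dots> = emeasure \<mu> B"
        using A(1) B by (intro emeasure_countable_partition[OF I disj _ _ cover(1)]) (auto simp: M_plusD[OF \<mu>])
      finally show "emeasure ?S (B \<times> UNIV) = emeasure \<mu> B" .
      have "emeasure ?S (UNIV \<times> B) = (\<integral>\<^sup>+ i. emeasure \<nu> (A i \<inter> B) \<partial>count_space I)"
        using B A(1) by (auto simp: em sets_Times_borel emeasure_Marg[OF M] emeasure_restr M_plusD[OF \<nu>]
            intro!: nn_integral_cong)
      also have "\<dots> = emeasure \<nu> B"
        using A(1) B by (intro emeasure_countable_partition[OF I disj _ _ cover(2)]) (auto simp: M_plusD[OF \<nu>])
      finally show "emeasure ?S (UNIV \<times> B) = emeasure \<nu> B" .
    qed
    interpret \<mu>: finite_measure \<mu> using \<mu> by (rule M_plusD)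
    have SP: "?S \<in> M_plus"
      using marg(1)[of UNIV] sets_eq_imp_space_eq[of ?S borel]
      by (auto simp: M_plus_def intro!: finite_measureI)
    have "?S \<in> Marg \<mu> \<nu>"
      by (rule MargI[OF SP]) (simp_all add: marg M_plusD[OF \<mu>] M_plusD[OF \<nu>])
    \<comment> \<open>A plan for comparison. On each piece \<open>Opt_iff\<close> forces the same
      diagonal masses on \<open>\<sigma> i\<close> and on the restriction of \<open>\<pi>\<close>;
      summation gives \<open>?S\<close> those of \<open>\<pi>\<close>, hence optimality.\<close>
    moreover obtain \<pi> where O: "\<pi> \<in> Opt \<mu> \<nu>" using ex_Opt by blast
    have "diag_cdf ?S t = diag_cdf \<pi> t" for t
    proof -
      have sq: "{..t} \<times> {..t} \<in> sets (borel :: (real \<times> real) measure)"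
        by (intro sets_Times_borel) auto
      have PS: "sets (restr_plan \<pi> (A i)) = sets borel" for i
        using O by (simp add: Opt_def Marg_def M_plusD)
      have "emeasure (\<sigma> i) ({..t} \<times> {..t}) = emeasure (restr_plan \<pi> (A i)) ({..t} \<times> {..t})"
        if i: "i \<in> I" for i
      proof -
        have "diag_cdf (\<sigma> i) t = diag_cdf (restr_plan \<pi> (A i)) t"
          using OE[OF i] restr_plan_in_Opt[OF O A(1)[OF i] A(2)[OF i]]
            atomless_pair.Opt_iff[OF atomless_pair_restr[OF O A(1)[OF i] A(2)[OF i]]] by simp
        moreover have "finite_measure (\<sigma> i)" "finite_measure (restr_plan \<pi> (A i))"
          using P[OF i] restr_plan_in_M_plus[of \<pi> "A i"] O A(1)[OF i]
          by (auto simp: Opt_def Marg_def M_plusD)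
        ultimately show ?thesis
          by (simp add: diag_cdf_def finite_measure.emeasure_eq_measure)
      qed
      then have "emeasure ?S ({..t} \<times> {..t})
          = emeasure (sum_measure I (\<lambda>i. restr_plan \<pi> (A i))) ({..t} \<times> {..t})"
        using sq PS by (simp add: em emeasure_sum_measure cong: nn_integral_cong_simp)
      then show ?thesis
        by (simp add: split[OF O] diag_cdf_def measure_def)
    qed
    ultimately show ?thesis
      using O by (simp add: Opt_iff)
  qed
  have "inj_on (sum_measure I) (\<Pi>\<^sub>E i\<in>I. ?E i)"
    using A(1) by (rule inj_on_sum_measure_Marg[OF _ disj \<mu> \<nu> EM])
  then show ?thesis
    using sub sup by (auto simp: is_direct_sum_def sum_set_def)
qed

text \<open>Applies \<open>is_direct_sum_Opt\<close> to the pair restricted to \<open>U\<close>,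
  whose coincidence set \<open>R.Z\<close> also contains the complement of \<open>U\<close>.\<close>

lemma is_direct_sum_Opt_components:
  assumes U: "open U" "saturated Z U" and C: "bij_betw C K (components U)"
  shows "is_direct_sum (Opt (restr \<mu> U) (restr \<nu> U)) K (\<lambda>k. Opt (restr \<mu> (C k)) (restr \<nu> (C k)))"
proof -
  obtain \<pi> where O: "\<pi> \<in> Opt \<mu> \<nu>" using ex_Opt by blast
  have UB: "U \<in> sets borel" using U(1) by auto
  interpret R: atomless_pair "restr \<mu> U" "restr \<nu> U"
    by (rule atomless_pair_restr[OF O UB U(2)])
  have comp: "C k \<in> components U" if "k \<in> K" for k
    using C that by (auto simp: bij_betw_def)
  have op: "open (C k)" "C k \<subseteq> U" if "k \<in> K" for k
    using open_components[OF U(1)] in_components_subset comp that by blast+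
  have "countable (components U)"
    using open_components[OF U(1)] pairwise_disjoint_components[of U]
    by (intro countable_disjoint_open_subsets) (simp_all add: pairwise_def disjnt_def)
  then have K: "countable K"
    using C countable_image_inj_on[of C K] by (auto simp: bij_betw_def)
  have disj: "disjoint_family_on C K"
    unfolding disjoint_family_on_def
    using C components_nonoverlap[OF comp comp] by (metis bij_betw_def inj_onD)
  have cov: "(\<Union>k\<in>K. C k) = U"
    using C Union_components[of U] by (auto simp: bij_betw_def)
  \<comment> \<open>Outside \<open>U\<close> the restricted distribution functions agree, so a
    segment avoiding \<open>R.Z\<close> cannot leave \<open>U\<close>.\<close>
  have "closed_segment x y \<subseteq> U" if "closed_segment x y \<inter> R.Z = {}" for x y
  proof
    fix t assume "t \<in> closed_segment x y"
    with that have "cdf (restr \<mu> U) t \<noteq> cdf (restr \<nu> U) t" by blast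
    then show "t \<in> U"
      using cdf_restr_diff[OF O UB U(2), of t] by (auto split: if_splits)
  qed
  then have "saturated R.Z U"
    by (auto simp: saturated_def)
  then have "is_direct_sum (Opt (restr \<mu> U) (restr \<nu> U)) K
      (\<lambda>k. Opt (restr (restr \<mu> U) (C k)) (restr (restr \<nu> U) (C k)))"
    using comp op K disj cov AE_restr[OF \<mu> UB] AE_restr[OF \<nu> UB]
    by (intro R.is_direct_sum_Opt) (auto intro: saturated_component)
  also have "?this \<longleftrightarrow> ?thesis"
    using op UB by (intro is_direct_sum_cong) (simp add: restr_restr \<mu> \<nu>)
  finally show ?thesis .
qed

end

section \<open>Decomposition along the components and the coincidence set\<close>

theorem theorem1:
  fixes \<mu> \<nu> :: "real measure"
    and Kp :: "'k set" and Ip :: "'k \<Rightarrow> real set"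
    and Km :: "'l set" and Im :: "'l \<Rightarrow> real set"
  assumes "\<mu> \<in> M_plus" and "\<nu> \<in> M_plus"
    and "atomless \<mu>" and "atomless \<nu>"
    and "measure \<mu> UNIV = measure \<nu> UNIV"
    and "(INF \<pi>\<in>Marg \<mu> \<nu>. J \<pi>) < \<infinity>"
    and "bij_betw Ip Kp (components {x. cdf \<mu> x > cdf \<nu> x})"
    and "bij_betw Im Km (components {x. cdf \<mu> x < cdf \<nu> x})"
  shows
    "(restr \<mu> {x. cdf \<mu> x = cdf \<nu> x} = restr \<nu> {x. cdf \<mu> x = cdf \<nu> x}
      \<and> (\<forall>k\<in>Kp. le_F (restr \<mu> (Ip k)) (restr \<nu> (Ip k)))
      \<and> (\<forall>k\<in>Km. le_F (restr \<nu> (Im k)) (restr \<mu> (Im k))))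
     \<and>
     (\<exists>Sp Sm.
        is_direct_sum Sp Kp (\<lambda>k. Opt (restr \<mu> (Ip k)) (restr \<nu> (Ip k)))
      \<and> is_direct_sum Sm Km (\<lambda>k. Opt (restr \<mu> (Im k)) (restr \<nu> (Im k)))
      \<and> is_direct_sum (Opt \<mu> \<nu>) {..<3}
          (nth [Sp, Sm, Opt (restr \<mu> {x. cdf \<mu> x = cdf \<nu> x}) (restr \<nu> {x. cdf \<mu> x = cdf \<nu> x})]))"
proof -
  interpret atomless_pair \<mu> \<nu>
    using assms(1-6) finite_cost_if_INF[OF assms(1,2,6)] by unfold_locales
  \<comment> \<open>The facts about saturated sets are derived through some optimal plan; any one
    serves.\<close>
  obtain \<pi> where O: "\<pi> \<in> Opt \<mu> \<nu>" using ex_Opt by blast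
  define Up where "Up = {x. cdf \<mu> x > cdf \<nu> x}"
  define Um where "Um = {x. cdf \<mu> x < cdf \<nu> x}"
  have cont: "continuous_on UNIV (cdf \<mu>)" "continuous_on UNIV (cdf \<nu>)"
    using atomless_cdf(1) assms(1-4) by auto
  have op: "open Up" "open Um"
    unfolding Up_def Um_def by (intro open_Collect_less cont)+
  have parts: "Up \<inter> Um = {}" "Um \<inter> Up = {}" "- Z \<subseteq> Up \<union> Um" "- Z \<subseteq> Um \<union> Up"
    by (auto simp: Up_def Um_def)
  have sat: "saturated Z Up" "saturated Z Um"
    using saturated_open_part[OF op parts(1,3)] saturated_open_part[OF op(2,1) parts(2,4)]
    by blast+
  \<comment> \<open>Vacuous: a segment starting in \<open>Z\<close> meets \<open>Z\<close>
    there.\<close>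
  have satZ: "saturated Z Z"
    unfolding saturated_def by fastforce
  have borel: "Up \<in> sets borel" "Um \<in> sets borel" "Z \<in> sets borel"
    using op closed_Z by auto
  have comp: "connected C" "C \<in> sets borel" "C \<subseteq> U" "saturated Z C"
    if "C \<in> components U" "open U" "saturated Z U" for C U
    using in_components_connected[OF that(1)] open_components[OF that(2,1)]
      in_components_subset[OF that(1)] saturated_component[OF that(3,1)] by auto
  \<comment> \<open>The difference in \<open>cdf_restr_diff\<close> vanishes off \<open>Z\<close> by
    restriction and on \<open>Z\<close> by the choice of \<open>Z\<close>; a finite measure is
    determined by its distribution function.\<close>
  have "restr \<mu> Z = restr \<nu> Z"
  proof (rule cdf_unique')
    show "cdf (restr \<mu> Z) = cdf (restr \<nu> Z)"
    proof
      fix t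
      show "cdf (restr \<mu> Z) t = cdf (restr \<nu> Z) t"
        using cdf_restr_diff[OF O borel(3) satZ, of t] by (auto split: if_splits)
    qed
  qed (intro finite_borel_measure_M_plus restr_in_M_plus borel \<mu> \<nu>)+
  moreover have "le_F (restr \<mu> (Ip k)) (restr \<nu> (Ip k))" if "k \<in> Kp" for k
  proof -
    have "Ip k \<in> components Up"
      using assms(7) that by (auto simp: bij_betw_def Up_def)
    note C = comp[OF this op(1) sat(1)]
    note diff = cdf_restr_diff[OF O C(2,4)]
    show ?thesis
    proof (rule le_F_restr)
      show "cdf (restr \<nu> (Ip k)) t < cdf (restr \<mu> (Ip k)) t" if "t \<in> Ip k" for t
        using diff[of t] C(3) that by (auto simp: Up_def)
      show "cdf (restr \<nu> (Ip k)) t = cdf (restr \<mu> (Ip k)) t" if "t \<notin> Ip k" for t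
        using diff[of t] that by simp
    qed (use C measure_saturated[OF O C(2,4)] in \<open>simp_all add: \<mu> \<nu> atomless_\<mu> atomless_\<nu>\<close>)
  qed
  moreover have "le_F (restr \<nu> (Im k)) (restr \<mu> (Im k))" if "k \<in> Km" for k
  proof -
    have "Im k \<in> components Um"
      using assms(8) that by (auto simp: bij_betw_def Um_def)
    note C = comp[OF this op(2) sat(2)]
    note diff = cdf_restr_diff[OF O C(2,4)]
    show ?thesis
    proof (rule le_F_restr)
      show "cdf (restr \<mu> (Im k)) t < cdf (restr \<nu> (Im k)) t" if "t \<in> Im k" for t
        using diff[of t] C(3) that by (auto simp: Um_def)
      show "cdf (restr \<mu> (Im k)) t = cdf (restr \<nu> (Im k)) t" if "t \<notin> Im k" for t
        using diff[of t] that by simp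
    qed (use C measure_saturated[OF O C(2,4)] in \<open>simp_all add: \<mu> \<nu> atomless_\<mu> atomless_\<nu>\<close>)
  qed
  moreover have "is_direct_sum (Opt (restr \<mu> Up) (restr \<nu> Up)) Kp (\<lambda>k. Opt (restr \<mu> (Ip k)) (restr \<nu> (Ip k)))"
    using assms(7) by (intro is_direct_sum_Opt_components op sat) (simp add: Up_def)
  moreover have "is_direct_sum (Opt (restr \<mu> Um) (restr \<nu> Um)) Km (\<lambda>k. Opt (restr \<mu> (Im k)) (restr \<nu> (Im k)))"
    using assms(8) by (intro is_direct_sum_Opt_components op sat) (simp add: Um_def)
  moreover have "is_direct_sum (Opt \<mu> \<nu>) {..<3}
    (nth [Opt (restr \<mu> Up) (restr \<nu> Up), Opt (restr \<mu> Um) (restr \<nu> Um), Opt (restr \<mu> Z) (restr \<nu> Z)])"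
  proof -
    \<comment> \<open>\<open>Up\<close>, \<open>Um\<close> and \<open>Z\<close> are saturated and
      partition the line, so \<open>is_direct_sum_Opt\<close> applied to them gives the outer
      sum.\<close>
    let ?A = "nth [Up, Um, Z]"
    have I3: "{..<3} = {0, 1, 2::nat}" by auto
    have disj: "disjoint_family_on ?A {..<3}"
      by (auto simp: disjoint_family_on_def I3 Up_def Um_def)
    have cover: "(\<Union>i\<in>{..<3}. ?A i) = UNIV"
      by (auto simp: I3 Up_def Um_def)
    have "?A i \<in> sets borel" "saturated Z (?A i)" if "i \<in> {..<3}" for i
      using that borel sat satZ by (auto simp: I3)
    then have "is_direct_sum (Opt \<mu> \<nu>) {..<3} (\<lambda>i. Opt (restr \<mu> (?A i)) (restr \<nu> (?A i)))"
      using disj cover by (intro is_direct_sum_Opt) auto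
    also have "?this \<longleftrightarrow> ?thesis"
      by (intro is_direct_sum_cong) (auto simp: I3)
    finally show ?thesis .
  qed
  ultimately show ?thesis by blast
qed

end
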